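(* Let $V$ be a finite set with $|V|\ge 2$, let $m\ge 1$ be an integer, and let $\mathbf r=(r(x,k)\colon x\in V,\ k\in\mathbb N)$ be a collection of positive numbers. Let $P$ be an irreducible stochastic matrix on $V$ with invariant law $\pi$, and let $Q$ be a stochastic matrix on $V$ with stationary law $\pi$. Then, for every constant $\kappa>0$, the inequality $$\mathcal E_{\mathrm{zrp}(P,\mathbf r,m)}(f,f)\ \ge\ \kappa\,\mathcal E_{\mathrm{zrp}(Q,\mathbf r,m)}(f,f)\qquad\text{for all } f\colon\Omega\to\mathbb R$$ holds if and only if $$\mathcal E_P(\phi,\phi)\ \ge\ \kappa\,\mathcal E_Q(\phi,\phi)\qquad\text{for all }\phi\colon V\to\mathbb R .$$ In other words, $$\min_f\left\{\frac{\mathcal E_{\mathrm{zrp}(P,\mathbf r,m)}(f,f)}{\mathcal E_{\mathrm{zrp}(Q,\mathbf r,m)}(f,f)}\right\}=\min_\phi\left\{\frac{\mathcal E_P(\phi,\phi)}{\mathcal E_Q(\phi,\phi)}\right\},$$ where the minimum on the left (resp. right) is over all non-constant functions $f\colon\Omega\to\mathbb R$ (resp. $\phi\colon V\to\mathbb R$), and a quotient with positive numerator and zero denominator is read as $+\infty$.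
   Context: $\mathbb N=\{1,2,\dots\}$, $\mathbb Z_+=\{0,1,2,\dots\}$. The state space is $\Omega=\{\eta\in\mathbb Z_+^V\colon \sum_{x\in V}\eta(x)=m\}$; $(\delta_x)_{x\in V}$ is the canonical basis of $\mathbb R^V$; by convention $r(x,0)=0$ for all $x\in V$. For a stochastic matrix $R$ on $V$ with stationary law $\pi$ (here $R=P$ or $R=Q$), the zero-range process $\mathrm{zrp}(R,\mathbf r,m)$ is the continuous-time Markov chain on $\Omega$ with generator $$(\mathcal L_R f)(\eta)=\sum_{(x,y)\in V^2} r(x,\eta(x))\,R(x,y)\,\bigl(f(\eta+\delta_y-\delta_x)-f(\eta)\bigr)$$ (terms with $\eta(x)=0$ being zero). The law $$\mu(\eta)=\frac1Z\prod_{x\in V}\prod_{k=1}^{\eta(x)}\frac{\pi(x)}{r(x,k)},$$ with $Z$ the normalization constant making $\mu$ a probability on $\Omega$, is stationary for it (the same $\mu$ for $P$ and $Q$). Its Dirichlet form is $\mathcal E_{\mathrm{zrp}(R,\mathbf r,m)}(f,g)=-\langle f,\mathcal L_R g\rangle_\mu$, where $\langle f,g\rangle_\mu=\sum_{\eta\in\Omega}\mu(\eta)f(\eta)g(\eta)$. The Dirichlet form of $R$ is $\mathcal E_R(\phi,\psi)=\langle\phi,(I-R)\psi\rangle_\pi$, where $\langle\phi,\psi\rangle_\pi=\sum_{x\in V}\pi(x)\phi(x)\psi(x)$. No reversibility is assumed. *)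

theory Defs
  imports "HOL-Analysis.Analysis"
begin

definition prob_vector :: "real ^ 'v::finite \<Rightarrow> bool" where
  "prob_vector \<pi> \<longleftrightarrow> (\<forall>x. 0 \<le> \<pi> $ x) \<and> (\<Sum>x\<in>UNIV. \<pi> $ x) = 1"

definition stochastic_matrix :: "real ^ 'v ^ 'v::finite \<Rightarrow> bool" where
  "stochastic_matrix R \<longleftrightarrow> (\<forall>x. prob_vector (R $ x))"

definition stationary_law :: "real ^ 'v ^ 'v::finite \<Rightarrow> real ^ 'v \<Rightarrow> bool" where
  "stationary_law R \<pi> \<longleftrightarrow> prob_vector \<pi> \<and> \<pi> v* R = \<pi>"

(* The power notation on the type of square matrices is taken componentwise,
   hence the explicit iteration of the matrix product. *)
definition matrix_pow :: "real ^ 'v ^ 'v::finite \<Rightarrow> nat \<Rightarrow> real ^ 'v ^ 'v" where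
  "matrix_pow R n = (((**) R) ^^ n) (mat 1)"

definition irreducible_matrix :: "real ^ 'v ^ 'v::finite \<Rightarrow> bool" where
  "irreducible_matrix R \<longleftrightarrow> (\<forall>x y. \<exists>n. 0 < matrix_pow R n $ x $ y)"

definition weighted_inner :: "real ^ 'v::finite \<Rightarrow> real ^ 'v \<Rightarrow> real ^ 'v \<Rightarrow> real" where
  "weighted_inner \<pi> \<phi> \<psi> = (\<Sum>x\<in>UNIV. \<pi> $ x * \<phi> $ x * \<psi> $ x)"

definition dirichlet_form ::
  "real ^ 'v::finite \<Rightarrow> real ^ 'v ^ 'v \<Rightarrow> real ^ 'v \<Rightarrow> real ^ 'v \<Rightarrow> real" where
  "dirichlet_form \<pi> R \<phi> \<psi> = weighted_inner \<pi> \<phi> ((mat 1 - R) *v \<psi>)"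

definition zrp_states :: "nat \<Rightarrow> (nat ^ 'v::finite) set" where
  "zrp_states m = {\<eta>. (\<Sum>x\<in>UNIV. \<eta> $ x) = m}"

(* Subtraction on the naturals truncates, so the target configuration is only
   meaningful when site x is occupied.  The other terms vanish under the
   convention r x 0 = 0, which has to be assumed of the rates. *)
definition zrp_generator ::
  "('v::finite \<Rightarrow> nat \<Rightarrow> real) \<Rightarrow> real ^ 'v ^ 'v \<Rightarrow> (nat ^ 'v \<Rightarrow> real) \<Rightarrow> nat ^ 'v \<Rightarrow> real" where
  "zrp_generator r R f \<eta> =
     (\<Sum>(x, y)\<in>UNIV. r x (\<eta> $ x) * R $ x $ y * (f (\<eta> + axis y 1 - axis x 1) - f \<eta>))"

definition zrp_weight ::
  "real ^ 'v::finite \<Rightarrow> ('v \<Rightarrow> nat \<Rightarrow> real) \<Rightarrow> nat ^ 'v \<Rightarrow> real" where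
  "zrp_weight \<pi> r \<eta> = (\<Prod>x\<in>UNIV. \<Prod>k=1..\<eta> $ x. \<pi> $ x / r x k)"

definition zrp_law ::
  "real ^ 'v::finite \<Rightarrow> ('v \<Rightarrow> nat \<Rightarrow> real) \<Rightarrow> nat \<Rightarrow> nat ^ 'v \<Rightarrow> real" where
  "zrp_law \<pi> r m \<eta> = zrp_weight \<pi> r \<eta> / (\<Sum>\<xi>\<in>zrp_states m. zrp_weight \<pi> r \<xi>)"

definition zrp_inner ::
  "real ^ 'v::finite \<Rightarrow> ('v \<Rightarrow> nat \<Rightarrow> real) \<Rightarrow> nat \<Rightarrow>
     (nat ^ 'v \<Rightarrow> real) \<Rightarrow> (nat ^ 'v \<Rightarrow> real) \<Rightarrow> real" where
  "zrp_inner \<pi> r m f g = (\<Sum>\<eta>\<in>zrp_states m. zrp_law \<pi> r m \<eta> * f \<eta> * g \<eta>)"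

definition zrp_dirichlet_form ::
  "real ^ 'v::finite \<Rightarrow> real ^ 'v ^ 'v \<Rightarrow> ('v \<Rightarrow> nat \<Rightarrow> real) \<Rightarrow> nat \<Rightarrow>
     (nat ^ 'v \<Rightarrow> real) \<Rightarrow> (nat ^ 'v \<Rightarrow> real) \<Rightarrow> real" where
  "zrp_dirichlet_form \<pi> R r m f g = - zrp_inner \<pi> r m f (zrp_generator r R g)"

(* Division on the extended reals gives a / 0 = \<infinity> for a > 0, which is the
   convention wanted for the quotients below. *)
definition dirichlet_ratio ::
  "real ^ 'v::finite \<Rightarrow> real ^ 'v ^ 'v \<Rightarrow> real ^ 'v ^ 'v \<Rightarrow> real ^ 'v \<Rightarrow> ereal" where
  "dirichlet_ratio \<pi> P Q \<phi> =
     ereal (dirichlet_form \<pi> P \<phi> \<phi>) / ereal (dirichlet_form \<pi> Q \<phi> \<phi>)"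

definition zrp_dirichlet_ratio ::
  "real ^ 'v::finite \<Rightarrow> real ^ 'v ^ 'v \<Rightarrow> real ^ 'v ^ 'v \<Rightarrow> ('v \<Rightarrow> nat \<Rightarrow> real) \<Rightarrow> nat \<Rightarrow>
     (nat ^ 'v \<Rightarrow> real) \<Rightarrow> ereal" where
  "zrp_dirichlet_ratio \<pi> P Q r m f =
     ereal (zrp_dirichlet_form \<pi> P r m f f) / ereal (zrp_dirichlet_form \<pi> Q r m f f)"

end

theory Submission imports Defs begin

text \<open>
  Removing one particle from \<open>\<eta> = \<xi> + \<delta>\<^sub>x\<close> turns \<open>\<mu>(\<eta>) r(x, \<eta>(x))\<close> into the product of \<open>\<pi>(x)\<close> and a factor
  depending only on \<open>\<xi>\<close>. Hence the Dirichlet form of the zero-range process at \<open>f\<close> is a positive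
  combination, over configurations \<open>\<xi>\<close> of \<open>m - 1\<close> particles, of the single-particle forms at
  \<open>x \<mapsto> f(\<xi> + \<delta>\<^sub>x)\<close>, so comparison of the latter lifts to the process. Conversely, for
  \<open>f(\<eta>) = \<Sum>\<^sub>x \<eta>(x) \<phi>(x)\<close> each of these functions is \<open>\<phi>\<close> up to an additive constant, and the process
  form reduces to a multiple, independent of the matrix, of the single-particle form at \<open>\<phi>\<close>.
\<close>

section \<open>Single-particle Dirichlet forms\<close>

text \<open>Rows of \<open>R\<close> sum to 1, so \<open>I - R\<close> acts by averaging
  differences. This is the shape that the zero-range generator produces.\<close>

lemma dirichlet_form_eq_sum:
  assumes "stochastic_matrix R"
  shows "dirichlet_form \<pi> R \<phi> \<psi> =
           (\<Sum>x\<in>UNIV. \<Sum>y\<in>UNIV. \<pi> $ x * R $ x $ y * (\<phi> $ x * (\<psi> $ x - \<psi> $ y)))"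
proof -
  have row: "(\<Sum>y\<in>UNIV. R $ x $ y) = 1" for x
    using assms by (auto simp: stochastic_matrix_def prob_vector_def)
  have "((mat 1 - R) *v \<psi>) $ x = (\<Sum>y\<in>UNIV. R $ x $ y * (\<psi> $ x - \<psi> $ y))" for x
  proof -
    have "((mat 1 - R) *v \<psi>) $ x = \<psi> $ x - (\<Sum>y\<in>UNIV. R $ x $ y * \<psi> $ y)"
      by (simp add: matrix_vector_mult_diff_rdistrib) (simp add: matrix_vector_mult_def)
    also have "\<dots> = (\<Sum>y\<in>UNIV. R $ x $ y) * \<psi> $ x - (\<Sum>y\<in>UNIV. R $ x $ y * \<psi> $ y)"
      by (simp add: row)
    also have "\<dots> = (\<Sum>y\<in>UNIV. R $ x $ y * (\<psi> $ x - \<psi> $ y))"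
      by (simp add: sum_distrib_left sum_subtractf algebra_simps)
    finally show ?thesis .
  qed
  then show ?thesis
    by (simp add: dirichlet_form_def weighted_inner_def sum_distrib_left mult.assoc mult.left_commute)
qed

text \<open>Stationarity gives the sums of \<open>\<phi>(x)^2\<close> and \<open>\<phi>(y)^2\<close>
  against \<open>\<pi>(x) R(x,y)\<close> the same value, so expanding the square yields twice the
  form. Nonnegativity, the zero set and the effect of affine maps can then be read off.\<close>

lemma dirichlet_form_eq_squares:
  assumes R: "stochastic_matrix R" and "stationary_law R \<pi>"
  shows "dirichlet_form \<pi> R \<phi> \<phi> =
           (\<Sum>x\<in>UNIV. \<Sum>y\<in>UNIV. \<pi> $ x * R $ x $ y * (\<phi> $ x - \<phi> $ y)\<^sup>2) / 2"
proof -
  have row: "(\<Sum>y\<in>UNIV. R $ x $ y) = 1" for x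
    using R by (auto simp: stochastic_matrix_def prob_vector_def)
  have col: "(\<Sum>x\<in>UNIV. \<pi> $ x * R $ x $ y) = \<pi> $ y" for y
  proof -
    have "(\<pi> v* R) $ y = \<pi> $ y"
      using assms by (simp add: stationary_law_def)
    then show ?thesis
      by (simp add: vector_matrix_mult_def mult.commute)
  qed
  have "(\<Sum>x\<in>UNIV. \<Sum>y\<in>UNIV. \<pi> $ x * R $ x $ y * (\<phi> $ y)\<^sup>2)
      = (\<Sum>y\<in>UNIV. (\<Sum>x\<in>UNIV. \<pi> $ x * R $ x $ y) * (\<phi> $ y)\<^sup>2)"
    by (subst sum.swap) (simp add: sum_distrib_right)
  also have "\<dots> = (\<Sum>x\<in>UNIV. \<pi> $ x * (\<Sum>y\<in>UNIV. R $ x $ y) * (\<phi> $ x)\<^sup>2)"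
    by (simp add: row col)
  also have "\<dots> = (\<Sum>x\<in>UNIV. \<Sum>y\<in>UNIV. \<pi> $ x * R $ x $ y * (\<phi> $ x)\<^sup>2)"
    by (simp add: sum_distrib_left sum_distrib_right)
  finally have swap: "(\<Sum>x\<in>UNIV. \<Sum>y\<in>UNIV. \<pi> $ x * R $ x $ y * (\<phi> $ y)\<^sup>2)
      = (\<Sum>x\<in>UNIV. \<Sum>y\<in>UNIV. \<pi> $ x * R $ x $ y * (\<phi> $ x)\<^sup>2)" .
  have "(\<Sum>x\<in>UNIV. \<Sum>y\<in>UNIV. \<pi> $ x * R $ x $ y * (\<phi> $ x - \<phi> $ y)\<^sup>2)
      = (\<Sum>x\<in>UNIV. \<Sum>y\<in>UNIV. 2 * (\<pi> $ x * R $ x $ y * (\<phi> $ x * (\<phi> $ x - \<phi> $ y)))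
          + \<pi> $ x * R $ x $ y * (\<phi> $ y)\<^sup>2 - \<pi> $ x * R $ x $ y * (\<phi> $ x)\<^sup>2)"
    by (intro sum.cong refl) (simp add: power2_eq_square algebra_simps)
  also have "\<dots> = 2 * dirichlet_form \<pi> R \<phi> \<phi>"
    by (simp add: sum.distrib sum_subtractf swap dirichlet_form_eq_sum[OF R] sum_distrib_left)
  finally show ?thesis
    by simp
qed

lemma dirichlet_form_nonneg:
  assumes "stochastic_matrix R" "stationary_law R \<pi>"
  shows "0 \<le> dirichlet_form \<pi> R \<phi> \<phi>"
  using assms unfolding dirichlet_form_eq_squares[OF assms]
  by (auto intro!: sum_nonneg divide_nonneg_nonneg mult_nonneg_nonneg
      simp: stochastic_matrix_def stationary_law_def prob_vector_def)

lemma dirichlet_form_affine: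
  assumes "stochastic_matrix R" "stationary_law R \<pi>"
  shows "dirichlet_form \<pi> R (\<chi> x. c * \<phi> $ x + d) (\<chi> x. c * \<phi> $ x + d) = c\<^sup>2 * dirichlet_form \<pi> R \<phi> \<phi>"
proof -
  have "(c * a + d - (c * b + d))\<^sup>2 = c\<^sup>2 * (a - b)\<^sup>2" for a b :: real
    by (simp add: power2_eq_square algebra_simps)
  then show ?thesis
    by (simp add: dirichlet_form_eq_squares[OF assms] sum_distrib_left mult.assoc mult.left_commute)
qed

lemma continuous_on_dirichlet_form:
  assumes "stochastic_matrix R" "stationary_law R \<pi>"
  shows "continuous_on S (\<lambda>\<phi>. dirichlet_form \<pi> R \<phi> \<phi>)"
  unfolding dirichlet_form_eq_squares[OF assms] by (intro continuous_intros) auto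

section \<open>Consequences of irreducibility\<close>

lemma matrix_pow_nonneg:
  assumes "stochastic_matrix R"
  shows "0 \<le> matrix_pow R n $ x $ y"
proof (induction n arbitrary: x y)
  case 0
  then show ?case by (simp add: matrix_pow_def mat_def)
next
  case (Suc n)
  have "matrix_pow R (Suc n) $ x $ y = (\<Sum>z\<in>UNIV. R $ x $ z * matrix_pow R n $ z $ y)"
    by (simp add: matrix_pow_def matrix_matrix_mult_def)
  then show ?case
    using assms Suc by (auto intro!: sum_nonneg mult_nonneg_nonneg
        simp: stochastic_matrix_def prob_vector_def)
qed

lemma vector_matrix_pow_fixed:
  assumes "\<pi> v* R = \<pi>"
  shows "\<pi> v* matrix_pow R n = \<pi>"
proof (induction n)
  case 0
  then show ?case by (simp add: matrix_pow_def)
next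
  case (Suc n)
  have "matrix_pow R (Suc n) = R ** matrix_pow R n"
    by (simp add: matrix_pow_def)
  then have "\<pi> v* matrix_pow R (Suc n) = (\<pi> v* R) v* matrix_pow R n"
    by (simp add: vector_matrix_mul_assoc)
  then show ?case
    by (simp add: assms Suc)
qed

text \<open>Some site carries mass, and invariance of \<pi> under every power of \<open>R\<close>
  transports part of that mass to \<open>y\<close>.\<close>

lemma stationary_law_pos:
  assumes R: "stochastic_matrix R" and "irreducible_matrix R" and \<pi>: "stationary_law R \<pi>"
  shows "0 < \<pi> $ y"
proof -
  have nonneg: "0 \<le> \<pi> $ x" for x
    using \<pi> by (simp add: stationary_law_def prob_vector_def)
  have "\<exists>x. \<pi> $ x \<noteq> 0"
  proof (rule ccontr)
    assume "\<not> ?thesis"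
    then have "(\<Sum>x\<in>UNIV. \<pi> $ x) = 0" by simp
    then show False using \<pi> by (simp add: stationary_law_def prob_vector_def)
  qed
  then obtain x where x: "\<pi> $ x > 0"
    using nonneg by (metis order_less_le)
  obtain n where n: "0 < matrix_pow R n $ x $ y"
    using assms by (auto simp: irreducible_matrix_def)
  have "(\<pi> v* matrix_pow R n) $ y = \<pi> $ y"
    using vector_matrix_pow_fixed[of \<pi> R n] \<pi> by (simp add: stationary_law_def)
  then have "\<pi> $ y = (\<Sum>z\<in>UNIV. matrix_pow R n $ z $ y * \<pi> $ z)"
    by (simp add: vector_matrix_mult_def mult.commute)
  also have "\<dots> > 0"
    using x n nonneg matrix_pow_nonneg[OF R] by (intro sum_pos2[of _ x]) auto
  finally show ?thesis .
qed

text \<open>If the sum of squares vanishes, \<phi> agrees across every transition of positive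
  probability, hence along every path; irreducibility then makes it constant.\<close>

lemma dirichlet_form_pos:
  fixes \<phi> :: "real ^ 'v::finite"
  assumes R: "stochastic_matrix R" and irr: "irreducible_matrix R" and \<pi>: "stationary_law R \<pi>"
    and nc: "\<not> (\<lambda>x. \<phi> $ x) constant_on UNIV"
  shows "0 < dirichlet_form \<pi> R \<phi> \<phi>"
proof (rule ccontr)
  have Rnonneg: "0 \<le> R $ x $ y" for x y
    using R by (simp add: stochastic_matrix_def prob_vector_def)
  have \<pi>pos: "0 < \<pi> $ x" for x
    using stationary_law_pos[OF R irr \<pi>] .
  assume "\<not> ?thesis"
  then have "dirichlet_form \<pi> R \<phi> \<phi> = 0"
    using dirichlet_form_nonneg[OF R \<pi>, of \<phi>] by simp
  then have "(\<Sum>x\<in>UNIV. \<Sum>y\<in>UNIV. \<pi> $ x * R $ x $ y * (\<phi> $ x - \<phi> $ y)\<^sup>2) = 0"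
    by (simp add: dirichlet_form_eq_squares[OF R \<pi>])
  then have "\<forall>x y. \<pi> $ x * R $ x $ y * (\<phi> $ x - \<phi> $ y)\<^sup>2 = 0"
    using \<pi>pos Rnonneg
    by (simp add: sum_nonneg_eq_0_iff sum_nonneg mult_nonneg_nonneg less_imp_le)
  then have step: "\<phi> $ x = \<phi> $ y" if "0 < R $ x $ y" for x y
    using \<pi>pos[of x] that by (metis eq_iff_diff_eq_0 less_irrefl mult_eq_0_iff power_eq_0_iff)
  have path: "\<phi> $ x = \<phi> $ y" if "0 < matrix_pow R n $ x $ y" for n x y
    using that
  proof (induction n arbitrary: x)
    case 0
    then show ?case by (simp add: matrix_pow_def mat_def split: if_splits)
  next
    case (Suc n)
    have "matrix_pow R (Suc n) $ x $ y = (\<Sum>z\<in>UNIV. R $ x $ z * matrix_pow R n $ z $ y)"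
      by (simp add: matrix_pow_def matrix_matrix_mult_def)
    \<comment> \<open>A positive sum has a positive term, which supplies the first vertex
      \<open>z\<close> of a path from \<open>x\<close> to \<open>y\<close>.\<close>
    with Suc.prems have "\<not> (\<forall>z. R $ x $ z * matrix_pow R n $ z $ y \<le> 0)"
      using sum_nonpos[of UNIV "\<lambda>z. R $ x $ z * matrix_pow R n $ z $ y"] by auto
    then obtain z where "0 < R $ x $ z * matrix_pow R n $ z $ y"
      by (auto simp: not_le)
    then have "0 < R $ x $ z" "0 < matrix_pow R n $ z $ y"
      using Rnonneg[of x z] matrix_pow_nonneg[OF R, of n z y] by (auto simp: zero_less_mult_iff)
    then show ?case
      using step Suc.IH by metis
  qed
  have "\<phi> $ x = \<phi> $ undefined" for x
    using path irr by (meson irreducible_matrix_def)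
  then have "(\<lambda>x. \<phi> $ x) constant_on UNIV"
    unfolding constant_on_def by blast
  with nc show False
    by contradiction
qed

text \<open>The form of \<open>Q\<close> may vanish on nonconstant functions, so the reciprocal
  quotient, with the positive form of \<open>P\<close> below, is maximised: it is finite and
  continuous, and compactness applies.\<close>

lemma dirichlet_form_ratio_max:
  fixes P Q :: "real ^ 'v ^ 'v::finite"
  assumes card: "CARD('v) \<ge> 2"
    and P: "stochastic_matrix P" "stationary_law P \<pi>" and irr: "irreducible_matrix P"
    and Q: "stochastic_matrix Q" "stationary_law Q \<pi>"
  obtains M \<phi> where "\<not> (\<lambda>x. \<phi> $ x) constant_on UNIV"
    and "dirichlet_form \<pi> Q \<phi> \<phi> = M * dirichlet_form \<pi> P \<phi> \<phi>"
    and "\<And>\<psi>. dirichlet_form \<pi> Q \<psi> \<psi> \<le> M * dirichlet_form \<pi> P \<psi> \<psi>"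
proof -
  let ?E = "\<lambda>R \<phi>. dirichlet_form \<pi> R \<phi> \<phi>"
  obtain x0 y0 :: 'v where xy: "x0 \<noteq> y0"
    using card card_le_Suc0_iff_eq[of "UNIV :: 'v set"] by auto
  \<comment> \<open>Both forms ignore additive constants and scale quadratically. Pinning the value
    at \<open>x0\<close> and the norm selects a compact set of representatives of the nonconstant
    functions.\<close>
  define S where "S = sphere 0 1 \<inter> {\<phi> :: real ^ 'v. \<phi> $ x0 = 0}"
  have nonconst: "\<not> (\<lambda>x. \<phi> $ x) constant_on UNIV" if "\<phi> \<in> S" for \<phi>
  proof
    assume "(\<lambda>x. \<phi> $ x) constant_on UNIV"
    then have "\<phi> $ x = \<phi> $ x0" for x
      by (metis UNIV_I constant_on_def)
    then have "\<phi> = 0"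
      using that by (simp add: S_def vec_eq_iff)
    then show False
      using that by (simp add: S_def)
  qed
  have "compact S"
    unfolding S_def by (intro compact_Int_closed compact_sphere closed_Collect_eq continuous_intros)
  moreover have "axis y0 1 \<in> S"
    using xy by (simp add: S_def) (simp add: axis_def)
  moreover have "?E P \<phi> \<noteq> 0" if "\<phi> \<in> S" for \<phi>
    using dirichlet_form_pos[OF P(1) irr P(2) nonconst[OF that]] by simp
  then have "continuous_on S (\<lambda>\<phi>. ?E Q \<phi> / ?E P \<phi>)"
    by (intro continuous_intros continuous_on_dirichlet_form P Q) auto
  ultimately obtain \<phi> where \<phi>: "\<phi> \<in> S" and max: "\<And>\<psi>. \<psi> \<in> S \<Longrightarrow> ?E Q \<psi> / ?E P \<psi> \<le> ?E Q \<phi> / ?E P \<phi>"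
    using continuous_attains_sup[of S] by blast
  define M where "M = ?E Q \<phi> / ?E P \<phi>"
  have le: "?E Q \<psi> \<le> M * ?E P \<psi>" for \<psi>
  proof -
    \<comment> \<open>Shift, then normalise, to land in \<open>S\<close>. The factor 1 here and the
      summand 0 in \<rho> match the pattern of \<open>dirichlet_form_affine\<close>.\<close>
    define \<theta> where "\<theta> = (\<chi> x. 1 * \<psi> $ x + - \<psi> $ x0)"
    have \<theta>: "?E R \<theta> = ?E R \<psi>" if "stochastic_matrix R" "stationary_law R \<pi>" for R
      unfolding \<theta>_def dirichlet_form_affine[OF that] by simp
    have \<theta>0: "\<theta> $ x0 = 0"
      by (simp add: \<theta>_def)
    show ?thesis
    proof (cases "\<theta> = 0")
      case True
      then have "?E R \<theta> = 0" for R
        by (simp add: dirichlet_form_def weighted_inner_def)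
      then show ?thesis
        using \<theta>[OF P] \<theta>[OF Q] by simp
    next
      case False
      define \<rho> where "\<rho> = (\<chi> x. inverse (norm \<theta>) * \<theta> $ x + 0)"
      have "\<rho> = inverse (norm \<theta>) *\<^sub>R \<theta>"
        by (simp add: \<rho>_def vec_eq_iff)
      then have "\<rho> \<in> S"
        using False \<theta>0 by (simp add: S_def)
      have \<rho>: "?E R \<rho> = (inverse (norm \<theta>))\<^sup>2 * ?E R \<psi>"
        if "stochastic_matrix R" "stationary_law R \<pi>" for R
        unfolding \<rho>_def dirichlet_form_affine[OF that] \<theta>[OF that] ..
      have "?E Q \<rho> \<le> M * ?E P \<rho>"
        using max[OF \<open>\<rho> \<in> S\<close>] dirichlet_form_pos[OF P(1) irr P(2) nonconst[OF \<open>\<rho> \<in> S\<close>]]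
        by (simp add: M_def pos_divide_le_eq)
      then show ?thesis
        using False by (simp add: \<rho>[OF P] \<rho>[OF Q] mult.left_commute[of M])
    qed
  qed
  have "?E Q \<phi> = M * ?E P \<phi>"
    using dirichlet_form_pos[OF P(1) irr P(2) nonconst[OF \<phi>]] by (simp add: M_def)
  with nonconst[OF \<phi>] le show thesis
    using that by blast
qed

section \<open>Decomposition of the zero-range Dirichlet form\<close>

lemma finite_zrp_states: "finite (zrp_states m :: (nat ^ 'v::finite) set)"
proof (rule finite_subset)
  show "zrp_states m \<subseteq> vec_lambda ` (UNIV \<rightarrow>\<^sub>E {..m} :: ('v \<Rightarrow> nat) set)"
  proof
    fix \<eta> :: "nat ^ 'v"
    assume "\<eta> \<in> zrp_states m"
    then have "vec_nth \<eta> \<in> UNIV \<rightarrow>\<^sub>E {..m}"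
      by (auto simp: zrp_states_def intro: member_le_sum[of _ UNIV])
    then show "\<eta> \<in> vec_lambda ` (UNIV \<rightarrow>\<^sub>E {..m})"
      by (metis image_eqI vec_nth_inverse)
  qed
  show "finite (vec_lambda ` (UNIV \<rightarrow>\<^sub>E {..m}) :: (nat ^ 'v) set)"
    by (intro finite_imageI finite_PiE) auto
qed

lemma zrp_states_add_axis: "\<xi> + axis x 1 \<in> zrp_states (Suc n) \<longleftrightarrow> \<xi> \<in> zrp_states n"
  by (simp add: zrp_states_def sum.distrib) (simp add: axis_def)

lemma bij_betw_add_axis:
  "bij_betw (\<lambda>\<xi>. \<xi> + axis x 1) (zrp_states n) {\<eta> \<in> zrp_states (Suc n). 0 < \<eta> $ x}"
proof (rule bij_betw_imageI)
  show "inj_on (\<lambda>\<xi>. \<xi> + axis x 1) (zrp_states n)"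
    by (auto simp: inj_on_def)
  have "\<eta> \<in> (\<lambda>\<xi>. \<xi> + axis x 1) ` zrp_states n" if "\<eta> \<in> zrp_states (Suc n)" "0 < \<eta> $ x" for \<eta>
  proof -
    \<comment> \<open>Truncated subtraction is exact here because site \<open>x\<close> is
      occupied.\<close>
    have "\<eta> = (\<eta> - axis x 1) + axis x 1"
      using that(2) by (auto simp: vec_eq_iff axis_def)
    then show ?thesis
      using that(1) by (metis image_eqI zrp_states_add_axis)
  qed
  then show "(\<lambda>\<xi>. \<xi> + axis x 1) ` zrp_states n = {\<eta> \<in> zrp_states (Suc n). 0 < \<eta> $ x}"
    by (auto simp: zrp_states_add_axis simp del: One_nat_def)
qed

lemma zrp_states_nonempty: "zrp_states n \<noteq> ({} :: (nat ^ 'v::finite) set)"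
proof -
  have "axis (undefined :: 'v) n \<in> zrp_states n"
    by (simp add: zrp_states_def axis_def)
  then show ?thesis by blast
qed

lemma zrp_weight_pos:
  assumes "\<And>x. 0 < \<pi> $ x" "\<And>x k. k \<ge> 1 \<Longrightarrow> 0 < r x k"
  shows "0 < zrp_weight \<pi> r \<eta>"
  using assms unfolding zrp_weight_def by (intro prod_pos) simp

text \<open>Only the factor at \<open>x\<close> changes, gaining
  \<open>\<pi>(x) / r(x, \<xi>(x) + 1)\<close>; the jump rate out of the new configuration cancels
  the denominator.\<close>

lemma zrp_weight_add_axis:
  assumes "r x (Suc (\<xi> $ x)) \<noteq> 0"
  shows "zrp_weight \<pi> r (\<xi> + axis x 1) * r x (Suc (\<xi> $ x)) = zrp_weight \<pi> r \<xi> * \<pi> $ x"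
proof -
  let ?g = "\<lambda>\<eta> z. \<Prod>k=1..\<eta> $ z. \<pi> $ z / r z k"
  have "prod (?g (\<xi> + axis x 1)) (UNIV - {x}) = prod (?g \<xi>) (UNIV - {x})"
    by (intro prod.cong refl) (simp add: axis_def)
  moreover have "?g (\<xi> + axis x 1) x = ?g \<xi> x * (\<pi> $ x / r x (Suc (\<xi> $ x)))"
    by (simp add: axis_def)
  ultimately show ?thesis
    using assms unfolding zrp_weight_def
    by (simp add: prod.remove[of UNIV x] del: One_nat_def)
qed

text \<open>The background \<xi> is frozen, and \<open>f\<close> is viewed as a function of the
  position of the one remaining particle.\<close>

definition zrp_section :: "(nat ^ 'v \<Rightarrow> real) \<Rightarrow> nat ^ 'v \<Rightarrow> real ^ 'v::finite" where
  "zrp_section f \<xi> = (\<chi> x. f (\<xi> + axis x 1))"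

text \<open>Used for \<xi> with \<open>m - 1\<close> particles, but normalised over \<open>m\<close>
  particles, so these weights need not sum to 1.\<close>

definition zrp_coeff ::
  "real ^ 'v::finite \<Rightarrow> ('v \<Rightarrow> nat \<Rightarrow> real) \<Rightarrow> nat \<Rightarrow> nat ^ 'v \<Rightarrow> real" where
  "zrp_coeff \<pi> r m \<xi> = zrp_weight \<pi> r \<xi> / (\<Sum>\<eta>\<in>zrp_states m. zrp_weight \<pi> r \<eta>)"

lemma zrp_coeff_pos:
  assumes "\<And>x. 0 < \<pi> $ x" "\<And>x k. k \<ge> 1 \<Longrightarrow> 0 < r x k"
  shows "0 < zrp_coeff \<pi> r m \<xi>"
  unfolding zrp_coeff_def
  by (intro divide_pos_pos sum_pos zrp_weight_pos finite_zrp_states zrp_states_nonempty assms)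

text \<open>A jump from \<open>x\<close> to \<open>y\<close> leads from
  \<open>\<xi> + \<delta>_x\<close> to \<open>\<xi> + \<delta>_y\<close>. Grouping jumps by the
  background \<xi> gives single-particle forms whose coefficients do not depend on
  \<open>R\<close>.\<close>

lemma zrp_dirichlet_form_decomposition:
  fixes R :: "real ^ 'v ^ 'v::finite"
  assumes R: "stochastic_matrix R"
    and r: "\<And>x k. k \<ge> 1 \<Longrightarrow> 0 < r x k" "\<And>x. r x 0 = 0"
  shows "zrp_dirichlet_form \<pi> R r (Suc n) f f =
           (\<Sum>\<xi>\<in>zrp_states n. zrp_coeff \<pi> r (Suc n) \<xi> *
              dirichlet_form \<pi> R (zrp_section f \<xi>) (zrp_section f \<xi>))"
proof -
  let ?\<mu> = "zrp_law \<pi> r (Suc n)"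
  define h where "h x y \<eta> =
    ?\<mu> \<eta> * r x (\<eta> $ x) * R $ x $ y * (f \<eta> * (f \<eta> - f (\<eta> + axis y 1 - axis x 1)))" for x y \<eta>
  have particle: "h x y (\<xi> + axis x 1) = zrp_coeff \<pi> r (Suc n) \<xi> *
      (\<pi> $ x * R $ x $ y * (f (\<xi> + axis x 1) * (f (\<xi> + axis x 1) - f (\<xi> + axis y 1))))" for x y \<xi>
  proof -
    have "\<xi> + axis x 1 + axis y 1 - axis x 1 = \<xi> + axis y (1::nat)"
      by (simp add: vec_eq_iff)
    moreover have "(\<xi> + axis x 1) $ x = Suc (\<xi> $ x)"
      by (simp add: axis_def)
    moreover have "?\<mu> (\<xi> + axis x 1) * r x (Suc (\<xi> $ x)) = zrp_coeff \<pi> r (Suc n) \<xi> * \<pi> $ x"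
      using zrp_weight_add_axis[of r x \<xi> \<pi>] r(1)[of "Suc (\<xi> $ x)" x]
      by (simp add: zrp_law_def zrp_coeff_def)
    ultimately show ?thesis
      by (simp add: h_def)
  qed
  have reindex: "(\<Sum>\<eta>\<in>zrp_states (Suc n). h x y \<eta>) = (\<Sum>\<xi>\<in>zrp_states n. h x y (\<xi> + axis x 1))" for x y
  proof -
    \<comment> \<open>Where \<open>x\<close> is empty, \<open>r x 0 = 0\<close> removes the term,
      together with the meaningless target given by truncated subtraction.\<close>
    have "(\<Sum>\<eta>\<in>zrp_states (Suc n). h x y \<eta>) = (\<Sum>\<eta>\<in>{\<eta> \<in> zrp_states (Suc n). 0 < \<eta> $ x}. h x y \<eta>)"
      by (intro sum.mono_neutral_right finite_zrp_states) (auto simp: h_def r)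
    also have "\<dots> = (\<Sum>\<xi>\<in>zrp_states n. h x y (\<xi> + axis x 1))"
      by (rule sum.reindex_bij_betw[OF bij_betw_add_axis, symmetric])
    finally show ?thesis .
  qed
  have "zrp_dirichlet_form \<pi> R r (Suc n) f f = (\<Sum>\<eta>\<in>zrp_states (Suc n). \<Sum>x\<in>UNIV. \<Sum>y\<in>UNIV. h x y \<eta>)"
    unfolding zrp_dirichlet_form_def zrp_inner_def zrp_generator_def sum_negf[symmetric]
    by (intro sum.cong refl)
      (simp add: h_def sum_distrib_left sum_negf[symmetric] UNIV_Times_UNIV[symmetric]
        sum.cartesian_product[symmetric] algebra_simps del: UNIV_Times_UNIV)
  also have "\<dots> = (\<Sum>x\<in>UNIV. \<Sum>y\<in>UNIV. \<Sum>\<eta>\<in>zrp_states (Suc n). h x y \<eta>)"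
    by (subst sum.swap, rule sum.cong[OF refl], rule sum.swap)
  also have "\<dots> = (\<Sum>x\<in>UNIV. \<Sum>y\<in>UNIV. \<Sum>\<xi>\<in>zrp_states n. h x y (\<xi> + axis x 1))"
    by (simp only: reindex)
  also have "\<dots> = (\<Sum>\<xi>\<in>zrp_states n. \<Sum>x\<in>UNIV. \<Sum>y\<in>UNIV. h x y (\<xi> + axis x 1))"
    by (subst (2) sum.swap, rule sum.cong[OF refl], rule sum.swap)
  also have "\<dots> = (\<Sum>\<xi>\<in>zrp_states n. zrp_coeff \<pi> r (Suc n) \<xi> *
              dirichlet_form \<pi> R (zrp_section f \<xi>) (zrp_section f \<xi>))"
    by (simp add: particle dirichlet_form_eq_sum[OF R] zrp_section_def sum_distrib_left del: One_nat_def)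
  finally show ?thesis .
qed

section \<open>Linear test functions\<close>

definition linear_observable :: "real ^ 'v::finite \<Rightarrow> nat ^ 'v \<Rightarrow> real" where
  "linear_observable \<phi> \<eta> = (\<Sum>x\<in>UNIV. real (\<eta> $ x) * \<phi> $ x)"

lemma zrp_section_linear_observable:
  "zrp_section (linear_observable \<phi>) \<xi> = (\<chi> x. \<phi> $ x + linear_observable \<phi> \<xi>)"
proof -
  have "(\<Sum>z\<in>UNIV. real (axis x 1 $ z) * \<phi> $ z) = \<phi> $ x" for x
    by (simp add: axis_def if_distrib[of real] if_distrib[of "\<lambda>t. t * _"] cong: if_cong)
  then show ?thesis
    by (simp add: vec_eq_iff zrp_section_def linear_observable_def sum.distrib algebra_simps)
qed

text \<open>Every section is \<phi> up to a constant, so all single-particle forms in the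
  decomposition coincide. The prefactor is the same for \<open>P\<close> and \<open>Q\<close> and
  cancels in quotients.\<close>

lemma zrp_dirichlet_form_linear_observable:
  assumes R: "stochastic_matrix R" "stationary_law R \<pi>"
    and r: "\<And>x k. k \<ge> 1 \<Longrightarrow> 0 < r x k" "\<And>x. r x 0 = 0"
  shows "zrp_dirichlet_form \<pi> R r (Suc n) (linear_observable \<phi>) (linear_observable \<phi>) =
           (\<Sum>\<xi>\<in>zrp_states n. zrp_coeff \<pi> r (Suc n) \<xi>) * dirichlet_form \<pi> R \<phi> \<phi>"
proof -
  have "dirichlet_form \<pi> R (\<chi> x. \<phi> $ x + d) (\<chi> x. \<phi> $ x + d) = dirichlet_form \<pi> R \<phi> \<phi>" for d
    using dirichlet_form_affine[OF R, of 1 \<phi> d] by simp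
  then show ?thesis
    by (simp add: zrp_dirichlet_form_decomposition[where r = r, OF R(1) r]
        zrp_section_linear_observable sum_distrib_right)
qed

text \<open>Constant sections mean that moving one particle leaves \<open>f\<close> unchanged, and
  all particles can be gathered at one site by such moves.\<close>

lemma constant_on_zrp_states:
  fixes f :: "nat ^ 'v::finite \<Rightarrow> real"
  assumes "\<And>\<xi>. \<xi> \<in> zrp_states n \<Longrightarrow> (\<lambda>x. zrp_section f \<xi> $ x) constant_on UNIV"
  shows "f constant_on zrp_states (Suc n)"
proof -
  fix x0 :: 'v
  have move: "f (\<xi> + axis x 1) = f (\<xi> + axis y 1)" if "\<xi> \<in> zrp_states n" for \<xi> x y
    using assms[OF that] unfolding constant_on_def zrp_section_def by (metis UNIV_I vec_lambda_beta)
  have "f \<eta> = f (axis x0 (Suc n))" if "\<eta> \<in> zrp_states (Suc n)" for \<eta>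
    using that
  \<comment> \<open>Induction on the number of particles away from \<open>x0\<close>.\<close>
  proof (induction "Suc n - \<eta> $ x0" arbitrary: \<eta> rule: less_induct)
    case less
    have total: "\<eta> $ x0 + (\<Sum>x\<in>UNIV - {x0}. \<eta> $ x) = Suc n"
      using less.prems by (simp add: zrp_states_def sum.remove[of UNIV x0])
    show ?case
    proof (cases "\<exists>x. x \<noteq> x0 \<and> 0 < \<eta> $ x")
      case False
      then have "(\<Sum>x\<in>UNIV - {x0}. \<eta> $ x) = 0"
        by (intro sum.neutral) auto
      with False have "\<eta> = axis x0 (Suc n)"
        using total by (auto simp: vec_eq_iff axis_def)
      then show ?thesis by simp
    next
      case True
      then obtain x where x: "x \<noteq> x0" "0 < \<eta> $ x" by blast
      obtain \<xi> where \<xi>: "\<xi> \<in> zrp_states n" "\<eta> = \<xi> + axis x 1"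
        using bij_betw_imp_surj_on[OF bij_betw_add_axis[of x n]] less.prems x by blast
      \<comment> \<open>Hence \<open>\<eta> $ x0 < Suc n\<close>, so the truncated difference
        strictly decreases when a particle moves to \<open>x0\<close>.\<close>
      have "0 < (\<Sum>x\<in>UNIV - {x0}. \<eta> $ x)"
        using x by (intro sum_pos2[of _ x]) auto
      moreover have "(\<xi> + axis x0 1) $ x0 = Suc (\<eta> $ x0)"
        using \<xi> x by (simp add: axis_def)
      ultimately have "f (\<xi> + axis x0 1) = f (axis x0 (Suc n))"
        using \<xi> total by (intro less.hyps) (auto simp: zrp_states_add_axis simp del: One_nat_def)
      then show ?thesis
        using move[OF \<xi>(1)] \<xi>(2) by metis
    qed
  qed
  then show ?thesis
    by (auto simp: constant_on_def)
qed

text \<open>A nonconstant \<open>f\<close> has a nonconstant section, whose term in the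
  decomposition is positive while the others are nonnegative.\<close>

lemma zrp_dirichlet_form_pos_iff:
  assumes R: "stochastic_matrix R" and irr: "irreducible_matrix R" and \<pi>: "stationary_law R \<pi>"
    and r: "\<And>x k. k \<ge> 1 \<Longrightarrow> 0 < r x k" "\<And>x. r x 0 = 0"
  shows "0 < zrp_dirichlet_form \<pi> R r (Suc n) f f \<longleftrightarrow> \<not> f constant_on zrp_states (Suc n)"
proof
  have coeff: "0 < zrp_coeff \<pi> r (Suc n) \<xi>" for \<xi>
    using stationary_law_pos[OF R irr \<pi>] r(1) by (rule zrp_coeff_pos)
  have decomp: "zrp_dirichlet_form \<pi> R r (Suc n) f f =
      (\<Sum>\<xi>\<in>zrp_states n. zrp_coeff \<pi> r (Suc n) \<xi> *
         dirichlet_form \<pi> R (zrp_section f \<xi>) (zrp_section f \<xi>))"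
    using R r by (rule zrp_dirichlet_form_decomposition)
  show "0 < zrp_dirichlet_form \<pi> R r (Suc n) f f" if "\<not> f constant_on zrp_states (Suc n)"
  proof -
    have "\<exists>\<xi>\<in>zrp_states n. \<not> (\<lambda>x. zrp_section f \<xi> $ x) constant_on UNIV"
    proof (rule ccontr)
      assume "\<not> ?thesis"
      then have "f constant_on zrp_states (Suc n)"
        by (intro constant_on_zrp_states) blast
      with that show False by contradiction
    qed
    then obtain \<xi> where "\<xi> \<in> zrp_states n" "\<not> (\<lambda>x. zrp_section f \<xi> $ x) constant_on UNIV"
      by blast
    then show ?thesis
      unfolding decomp using coeff
      by (intro sum_pos2[of _ \<xi>] finite_zrp_states mult_pos_pos mult_nonneg_nonneg
          dirichlet_form_pos dirichlet_form_nonneg assms) (auto intro: less_imp_le)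
  qed
  show "\<not> f constant_on zrp_states (Suc n)" if "0 < zrp_dirichlet_form \<pi> R r (Suc n) f f"
  proof
    assume "f constant_on zrp_states (Suc n)"
    then obtain c where c: "\<And>\<eta>. \<eta> \<in> zrp_states (Suc n) \<Longrightarrow> f \<eta> = c"
      by (auto simp: constant_on_def)
    have "zrp_section f \<xi> = (\<chi> x. c)" if "\<xi> \<in> zrp_states n" for \<xi>
      using that c by (simp add: zrp_section_def zrp_states_add_axis del: One_nat_def)
    then have "zrp_dirichlet_form \<pi> R r (Suc n) f f = 0"
      by (simp add: decomp dirichlet_form_eq_sum[OF R])
    with that show False by simp
  qed
qed

section \<open>Comparison\<close>

text \<open>With arbitrary real \<open>a\<close> and \<open>b\<close>, one statement covers the
  equivalence for \<kappa>, the bound by the maximal quotient, and nonnegativity of the form of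
  \<open>Q\<close>.\<close>

lemma zrp_dirichlet_form_comparison:
  fixes P Q :: "real ^ 'v ^ 'v::finite"
  assumes P: "stochastic_matrix P" "stationary_law P \<pi>" and irr: "irreducible_matrix P"
    and Q: "stochastic_matrix Q" "stationary_law Q \<pi>"
    and r: "\<And>x k. k \<ge> 1 \<Longrightarrow> 0 < r x k" "\<And>x. r x 0 = 0"
  shows "(\<forall>f. a * zrp_dirichlet_form \<pi> Q r (Suc n) f f \<le> b * zrp_dirichlet_form \<pi> P r (Suc n) f f) \<longleftrightarrow>
         (\<forall>\<phi>. a * dirichlet_form \<pi> Q \<phi> \<phi> \<le> b * dirichlet_form \<pi> P \<phi> \<phi>)" (is "?L \<longleftrightarrow> ?R")
proof
  have coeff: "0 < zrp_coeff \<pi> r (Suc n) \<xi>" for \<xi>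
    using stationary_law_pos[OF P(1) irr P(2)] r(1) by (rule zrp_coeff_pos)
  show ?R if ?L
  proof
    fix \<phi> :: "real ^ 'v"
    have "0 < (\<Sum>\<xi>\<in>zrp_states n. zrp_coeff \<pi> r (Suc n) \<xi>)"
      by (intro sum_pos finite_zrp_states zrp_states_nonempty coeff)
    moreover have "a * zrp_dirichlet_form \<pi> Q r (Suc n) (linear_observable \<phi>) (linear_observable \<phi>)
        \<le> b * zrp_dirichlet_form \<pi> P r (Suc n) (linear_observable \<phi>) (linear_observable \<phi>)"
      using that by blast
    ultimately show "a * dirichlet_form \<pi> Q \<phi> \<phi> \<le> b * dirichlet_form \<pi> P \<phi> \<phi>"
      by (simp add: zrp_dirichlet_form_linear_observable[where r = r, OF P r]
          zrp_dirichlet_form_linear_observable[where r = r, OF Q r]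
          mult.left_commute[of a] mult.left_commute[of b])
  qed
  show ?L if ?R
    using that coeff
    by (auto simp: zrp_dirichlet_form_decomposition[where r = r, OF P(1) r]
        zrp_dirichlet_form_decomposition[where r = r, OF Q(1) r]
        sum_distrib_left mult.left_commute[of a] mult.left_commute[of b]
        intro!: sum_mono mult_left_mono intro: less_imp_le)
qed

text \<open>The junk value \<open>0 / 0 = 0\<close> is excluded by the positivity of the numerators.\<close>

lemma ereal_quotient_le:
  assumes "0 < p" "0 < p0" "0 \<le> q" "q \<le> M * p" "q0 = M * p0"
  shows "ereal p0 / ereal q0 \<le> ereal p / ereal q"
proof (cases "q = 0")
  case True
  then show ?thesis using assms by simp
next
  case False
  then have "0 < q" using assms by simp
  \<comment> \<open>Then \<open>q0 = M * p0\<close> is positive too, so both quotients are finite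
    and cross-multiplication applies.\<close>
  then have "0 < M" using assms by (smt (verit) zero_less_mult_iff)
  then show ?thesis
    using assms \<open>0 < q\<close> by (simp add: field_simps)
qed

theorem theorem2:
  fixes P Q :: "real ^ 'v ^ 'v::finite"
    and \<pi> :: "real ^ 'v"
    and r :: "'v \<Rightarrow> nat \<Rightarrow> real"
    and m :: nat
  assumes "CARD('v) \<ge> 2"
    and "m \<ge> 1"
    and "\<And>x k. k \<ge> 1 \<Longrightarrow> r x k > 0"
    and "\<And>x. r x 0 = 0"
    and "stochastic_matrix P"
    and "irreducible_matrix P"
    and "stationary_law P \<pi>"
    and "stochastic_matrix Q"
    and "stationary_law Q \<pi>"
  shows "(\<forall>\<kappa>>0.
            (\<forall>f. zrp_dirichlet_form \<pi> P r m f f \<ge> \<kappa> * zrp_dirichlet_form \<pi> Q r m f f) \<longleftrightarrow>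
            (\<forall>\<phi>. dirichlet_form \<pi> P \<phi> \<phi> \<ge> \<kappa> * dirichlet_form \<pi> Q \<phi> \<phi>)) \<and>
         (\<exists>f \<phi>.
            is_arg_min (zrp_dirichlet_ratio \<pi> P Q r m) (\<lambda>f. \<not> f constant_on zrp_states m) f \<and>
            is_arg_min (dirichlet_ratio \<pi> P Q) (\<lambda>\<phi>. \<not> (\<lambda>x. \<phi> $ x) constant_on UNIV) \<phi> \<and>
            zrp_dirichlet_ratio \<pi> P Q r m f = dirichlet_ratio \<pi> P Q \<phi>)"
proof -
  note r = assms(3,4) and P = assms(5,7) and irr = assms(6) and Q = assms(8,9)
  obtain n where m: "m = Suc n"
    using assms(2) by (cases m) auto
  note comparison = zrp_dirichlet_form_comparison[where r = r, OF P irr Q r]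
  have compare: "\<forall>\<kappa>>0.
            (\<forall>f. zrp_dirichlet_form \<pi> P r m f f \<ge> \<kappa> * zrp_dirichlet_form \<pi> Q r m f f) \<longleftrightarrow>
            (\<forall>\<phi>. dirichlet_form \<pi> P \<phi> \<phi> \<ge> \<kappa> * dirichlet_form \<pi> Q \<phi> \<phi>)"
    using comparison[where b = 1] by (simp add: m)
  \<comment> \<open>A maximiser of the reciprocal quotient minimises the original one. If
    \<open>M = 0\<close>, the form of \<open>Q\<close> vanishes identically and every quotient is
    infinite.\<close>
  obtain M \<phi> where nc: "\<not> (\<lambda>x. \<phi> $ x) constant_on UNIV"
    and eq: "dirichlet_form \<pi> Q \<phi> \<phi> = M * dirichlet_form \<pi> P \<phi> \<phi>"
    and le: "\<And>\<psi>. dirichlet_form \<pi> Q \<psi> \<psi> \<le> M * dirichlet_form \<pi> P \<psi> \<psi>"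
    using dirichlet_form_ratio_max[OF assms(1) P irr Q] by blast
  \<comment> \<open>Both forms at \<open>f\<close> are \<open>C\<close> times those at \<phi>, so
    \<open>f\<close> has the same quotient and is the candidate minimiser for the process.\<close>
  define f where "f = linear_observable \<phi>"
  define C where "C = (\<Sum>\<xi>\<in>zrp_states n. zrp_coeff \<pi> r (Suc n) \<xi>)"
  have C: "0 < C"
    unfolding C_def using stationary_law_pos[OF P(1) irr P(2)] r(1)
    by (intro sum_pos finite_zrp_states zrp_states_nonempty zrp_coeff_pos)
  have zP: "zrp_dirichlet_form \<pi> P r m f f = C * dirichlet_form \<pi> P \<phi> \<phi>"
    unfolding m f_def C_def by (rule zrp_dirichlet_form_linear_observable[where r = r, OF P r])
  have zQ: "zrp_dirichlet_form \<pi> Q r m f f = C * dirichlet_form \<pi> Q \<phi> \<phi>"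
    unfolding m f_def C_def by (rule zrp_dirichlet_form_linear_observable[where r = r, OF Q r])
  note pos = dirichlet_form_pos[OF P(1) irr P(2)]
  have zpos: "0 < zrp_dirichlet_form \<pi> P r m g g \<longleftrightarrow> \<not> g constant_on zrp_states m" for g
    unfolding m by (rule zrp_dirichlet_form_pos_iff[where r = r, OF P(1) irr P(2) r])
  have zQ_nonneg: "0 \<le> zrp_dirichlet_form \<pi> Q r m g g" for g
    \<comment> \<open>For these values both sides of the comparison assert that minus the form of
      \<open>Q\<close> is at most 0.\<close>
    using comparison[where a = "-1" and b = 0 and n = n] dirichlet_form_nonneg[OF Q] by (simp add: m)
  have zle: "zrp_dirichlet_form \<pi> Q r m g g \<le> M * zrp_dirichlet_form \<pi> P r m g g" for g
    using comparison[where a = 1 and b = M and n = n] le by (simp add: m)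
  have fpos: "0 < zrp_dirichlet_form \<pi> P r m f f"
    using C pos[OF nc] by (simp add: zP)
  have "is_arg_min (zrp_dirichlet_ratio \<pi> P Q r m) (\<lambda>f. \<not> f constant_on zrp_states m) f"
    unfolding is_arg_min_linorder zrp_dirichlet_ratio_def
  proof (intro conjI allI impI)
    show "\<not> f constant_on zrp_states m"
      using fpos zpos by blast
    fix g :: "nat ^ 'v \<Rightarrow> real"
    assume "\<not> g constant_on zrp_states m"
    then have "0 < zrp_dirichlet_form \<pi> P r m g g"
      using zpos by blast
    then show "ereal (zrp_dirichlet_form \<pi> P r m f f) / ereal (zrp_dirichlet_form \<pi> Q r m f f)
        \<le> ereal (zrp_dirichlet_form \<pi> P r m g g) / ereal (zrp_dirichlet_form \<pi> Q r m g g)"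
      using fpos zQ_nonneg zle by (rule ereal_quotient_le) (simp add: zP zQ eq)
  qed
  moreover have "is_arg_min (dirichlet_ratio \<pi> P Q) (\<lambda>\<phi>. \<not> (\<lambda>x. \<phi> $ x) constant_on UNIV) \<phi>"
    unfolding is_arg_min_linorder dirichlet_ratio_def
  proof (intro conjI allI impI)
    show "\<not> (\<lambda>x. \<phi> $ x) constant_on UNIV"
      by (rule nc)
    fix \<psi> :: "real ^ 'v"
    assume "\<not> (\<lambda>x. \<psi> $ x) constant_on UNIV"
    from pos[OF this] pos[OF nc] dirichlet_form_nonneg[OF Q] le eq
    show "ereal (dirichlet_form \<pi> P \<phi> \<phi>) / ereal (dirichlet_form \<pi> Q \<phi> \<phi>)
        \<le> ereal (dirichlet_form \<pi> P \<psi> \<psi>) / ereal (dirichlet_form \<pi> Q \<psi> \<psi>)"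
      by (rule ereal_quotient_le)
  qed
  moreover have "zrp_dirichlet_ratio \<pi> P Q r m f = dirichlet_ratio \<pi> P Q \<phi>"
    using C pos[OF nc] by (simp add: zrp_dirichlet_ratio_def dirichlet_ratio_def zP zQ)
  ultimately show ?thesis
    using compare by blast
qed

end
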